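(* Let $\|\cdot\|$ be a norm on $\mathbb{R}^d$ (the source norm), with associated family $\{\|\cdot\|^{\star\mathrm{sn}}_{\star,(K)}\}_{K\subset V}$ of generalized local-$K$-support dual norms. Suppose that both the norm $\|\cdot\|$ and its dual norm $\|\cdot\|_\star$ are orthant-strictly monotonic. Then, for any nondecreasing finite-valued set function $F:2^V\to\mathbb{R}$ such that $F(\emptyset)=0$, we have $$ F(\mathrm{supp}(x)) = \frac{1}{\|x\|}\ \min_{z}\ \sum_{\emptyset\subsetneq K\subset V}\|z_{(K)}\|^{\star\mathrm{sn}}_{\star,(K)}\,F(K),\qquad \forall x\in\mathbb{R}^d\setminus\{0\}, $$ where the minimum is over all families $z=\{z_{(K)}\}_{\emptyset\subsetneq K\subset V}$ with $z_{(K)}\in\mathcal{R}_K$ for every $K$, satisfying $$\sum_{\emptyset\subsetneq K\subset V}\|z_{(K)}\|^{\star\mathrm{sn}}_{\star,(K)}\le\|x\| \quad\text{and}\quad \sum_{\emptyset\subsetneq K\subset V}z_{(K)}=x .$$ When $\mathrm{supp}(x)=L\neq\emptyset$, the minimum is achieved at the family $z$ such that $z_{(K)}=0$ for $K\ne L$ and $z_{(L)}=x$.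
   Context: $d\ge 1$ is an integer, $V=\{1,\ldots,d\}$, $\langle\cdot,\cdot\rangle$ is the standard scalar product on $\mathbb{R}^d$. The support mapping is $\mathrm{supp}(x)=\{j\in V: x_j\neq 0\}$. A set function $F$ is nondecreasing if $J\subset K\subset V$ implies $F(J)\le F(K)$. For $K\subset V$, $\mathcal{R}_K=\{x\in\mathbb{R}^d: x_j=0\ \forall j\notin K\}$, and for $y\in\mathbb{R}^d$, $y_K\in\mathcal{R}_K$ denotes the orthogonal projection of $y$ on $\mathcal{R}_K$ (components outside $K$ set to zero). The dual norm is $\|y\|_\star=\sup_{\|x\|\le 1}\langle x,y\rangle$. A norm $N$ on $\mathbb{R}^d$ is orthant-strictly monotonic if for all $x,x'\in\mathbb{R}^d$: if $|x_i|\le|x'_i|$ for all $i$ with at least one strict inequality, and $x_ix'_i\ge 0$ for all $i$, then $N(x)<N(x')$. For nonempty $K\subset V$, the generalized local-top-$K$ dual norm is the norm on $\mathcal{R}_K$ given by $\|y\|^{\mathrm{tn}}_{\star,(K)}=\sup_{J\subset K}\|y_J\|_\star$, $y\in\mathcal{R}_K$. The generalized local-$K$-support dual norm $\|\cdot\|^{\star\mathrm{sn}}_{\star,(K)}$ is its dual norm on the subspace $\mathcal{R}_K$: $\|x\|^{\star\mathrm{sn}}_{\star,(K)}=\sup\{\langle x,y\rangle: y\in\mathcal{R}_K,\ \|y\|^{\mathrm{tn}}_{\star,(K)}\le 1\}$, $x\in\mathcal{R}_K$. *)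

theory Defs
  imports "HOL-Analysis.Analysis"
begin

text \<open>
  The index set \<open>V = {1, \<dots>, d}\<close> is the universe of the type \<open>'n\<close>, and \<open>d = CARD('n) \<ge> 1\<close>.
  Set functions on \<open>V\<close> have type \<open>'n set \<Rightarrow> real\<close>, so that nondecreasing is \<open>mono\<close>.
\<close>

definition is_norm :: "('a::real_vector \<Rightarrow> real) \<Rightarrow> bool" where
  "is_norm N \<longleftrightarrow>
     (\<forall>x. N x \<ge> 0) \<and> (\<forall>x. N x = 0 \<longleftrightarrow> x = 0) \<and>
     (\<forall>c x. N (c *\<^sub>R x) = \<bar>c\<bar> * N x) \<and> (\<forall>x y. N (x + y) \<le> N x + N y)"

definition dual_norm :: "(real ^ 'n \<Rightarrow> real) \<Rightarrow> real ^ 'n \<Rightarrow> real" where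
  "dual_norm N y = (SUP x\<in>{x. N x \<le> 1}. x \<bullet> y)"

definition orthant_strictly_monotonic :: "(real ^ 'n \<Rightarrow> real) \<Rightarrow> bool" where
  "orthant_strictly_monotonic N \<longleftrightarrow>
     (\<forall>x x'. (\<forall>i. \<bar>x $ i\<bar> \<le> \<bar>x' $ i\<bar>) \<and> (\<exists>i. \<bar>x $ i\<bar> < \<bar>x' $ i\<bar>) \<and> (\<forall>i. x $ i * x' $ i \<ge> 0)
        \<longrightarrow> N x < N x')"

definition supp :: "real ^ 'n \<Rightarrow> 'n set" where
  "supp x = {j. x $ j \<noteq> 0}"

definition coord_subspace :: "'n set \<Rightarrow> (real ^ 'n) set" where
  "coord_subspace K = {x. \<forall>j. j \<notin> K \<longrightarrow> x $ j = 0}"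

definition coord_proj :: "'n set \<Rightarrow> real ^ 'n \<Rightarrow> real ^ 'n" where
  "coord_proj K y = (\<chi> j. if j \<in> K then y $ j else 0)"

text \<open>
  The next two functions are norms only on \<open>coord_subspace K\<close>, for nonempty \<open>K\<close>. Their values
  elsewhere are never used.
\<close>

definition local_top_dual_norm :: "(real ^ 'n \<Rightarrow> real) \<Rightarrow> 'n set \<Rightarrow> real ^ 'n \<Rightarrow> real" where
  "local_top_dual_norm N K y = (SUP J\<in>{J. J \<subseteq> K}. dual_norm N (coord_proj J y))"

definition local_support_dual_norm :: "(real ^ 'n \<Rightarrow> real) \<Rightarrow> 'n set \<Rightarrow> real ^ 'n \<Rightarrow> real" where
  "local_support_dual_norm N K x =
     (SUP y\<in>{y \<in> coord_subspace K. local_top_dual_norm N K y \<le> 1}. x \<bullet> y)"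

text \<open>
  A family indexed by the nonempty subsets of \<open>V\<close> is a function on all of \<open>'n set\<close> whose value
  at \<open>{}\<close> is unconstrained and does not enter the constraints or the objective.
\<close>

definition feasible :: "(real ^ 'n \<Rightarrow> real) \<Rightarrow> real ^ 'n \<Rightarrow> ('n set \<Rightarrow> real ^ 'n) \<Rightarrow> bool" where
  "feasible N x z \<longleftrightarrow>
     (\<forall>K. K \<noteq> {} \<longrightarrow> z K \<in> coord_subspace K) \<and>
     (\<Sum>K\<in>{K. K \<noteq> {}}. local_support_dual_norm N K (z K)) \<le> N x \<and>
     (\<Sum>K\<in>{K. K \<noteq> {}}. z K) = x"

definition objective ::
    "(real ^ 'n \<Rightarrow> real) \<Rightarrow> ('n set \<Rightarrow> real) \<Rightarrow> ('n set \<Rightarrow> real ^ 'n) \<Rightarrow> real" where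
  "objective N F z = (\<Sum>K\<in>{K. K \<noteq> {}}. local_support_dual_norm N K (z K) * F K)"

end

theory Submission
  imports Defs
begin

text \<open>
  Orthant-monotonicity makes coordinate projections nonexpansive for \<open>dual_norm N\<close>. The maximum
  defining the local-top-\<open>K\<close> dual norm is therefore attained at \<open>J = K\<close>, so that norm is the
  restriction of \<open>dual_norm N\<close> to \<open>coord_subspace K\<close>; and projecting a norming functional of
  \<open>x \<in> coord_subspace K\<close> shows that the local-\<open>K\<close>-support dual norm is the restriction of \<open>N\<close>
  (\<open>local_support_dual_norm_eq\<close>). The problem thus becomes the minimisation of
  \<open>\<Sum>K. N (z K) * F K\<close> over decompositions \<open>x = \<Sum>K. z K\<close> with \<open>\<Sum>K. N (z K) \<le> N x\<close>.

  By the triangle inequality the constraint \<open>\<Sum>K. N (z K) \<le> N x\<close> must be an equality, so a norming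
  functional \<open>y\<close> of \<open>x\<close>, of dual norm at most one, norms every \<open>z K\<close>. Strict monotonicity
  of \<open>N\<close> forces \<open>y\<close> to be nonzero on all of \<open>supp x\<close> (\<open>norming_vector_supp\<close>). If \<open>K\<close> misses a
  point of \<open>supp x\<close>, strict monotonicity of the dual norm makes the projection of \<open>y\<close> on
  \<open>coord_subspace K\<close> of dual norm less than one, and it cannot norm a nonzero \<open>z K\<close>.
  Hence only sets \<open>K \<supseteq> supp x\<close> carry mass (\<open>feasible_vanishes\<close>), where \<open>F K \<ge> F (supp x)\<close>, and the
  objective is at least \<open>N x * F (supp x)\<close>. Placing all of \<open>x\<close> at \<open>supp x\<close> attains this value.
\<close>

section \<open>Norms and their norming functionals\<close>

lemma is_normD:
  assumes "is_norm N"
  shows "N x \<ge> 0" "N x = 0 \<longleftrightarrow> x = 0" "N (c *\<^sub>R x) = \<bar>c\<bar> * N x" "N (x + y) \<le> N x + N y"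
  using assms by (auto simp: is_norm_def)

lemma is_norm_convex_on:
  assumes "is_norm N" "convex S"
  shows "convex_on S N"
proof (rule convex_onI)
  fix t x y assume "0 < (t::real)" "t < 1"
  then show "N ((1 - t) *\<^sub>R x + t *\<^sub>R y) \<le> (1 - t) * N x + t * N y"
    using is_normD(4)[OF assms(1), of "(1 - t) *\<^sub>R x" "t *\<^sub>R y"]
    by (simp add: is_normD(3)[OF assms(1)])
qed (fact assms(2))

text \<open>
  Half of the equivalence of norms in finite dimension: a norm is convex, hence continuous, and
  attains a positive minimum on the Euclidean unit sphere. It makes the supremum in \<open>dual_norm\<close> finite.
\<close>

lemma is_norm_lower_bound:
  fixes N :: "'a::euclidean_space \<Rightarrow> real"
  assumes "is_norm N"
  obtains m where "m > 0" "\<And>x. m * norm x \<le> N x"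
proof -
  have cont: "continuous_on UNIV N"
    by (intro convex_on_continuous is_norm_convex_on assms) auto
  have "sphere (0::'a) 1 \<noteq> {}" by simp
  then obtain s where s: "s \<in> sphere 0 1" and min: "\<And>v. v \<in> sphere 0 1 \<Longrightarrow> N s \<le> N v"
    using continuous_attains_inf[OF compact_sphere _ continuous_on_subset[OF cont]]
    by (metis subset_UNIV)
  show thesis
  proof
    have "s \<noteq> 0" using s by auto
    then show "N s > 0"
      using is_normD(1,2)[OF assms, of s] by linarith
    fix x
    show "N s * norm x \<le> N x"
    proof (cases "x = 0")
      case False
      then have "N s \<le> N ((1 / norm x) *\<^sub>R x)"
        by (intro min) simp
      also have "\<dots> = N x / norm x"
        by (simp only: is_normD(3)[OF assms]) simp
      finally show ?thesis using False by (simp add: field_simps)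
    qed (simp add: is_normD(1)[OF assms])
  qed
qed

lemma bdd_above_dual_norm:
  fixes N :: "'a::euclidean_space \<Rightarrow> real"
  assumes "is_norm N"
  shows "bdd_above ((\<lambda>x. x \<bullet> y) ` {x. N x \<le> 1})"
proof -
  obtain m where m: "m > 0" "\<And>x. m * norm x \<le> N x"
    using is_norm_lower_bound[OF assms] by blast
  have "x \<bullet> y \<le> 1 / m * norm y" if "N x \<le> 1" for x
  proof -
    have "norm x \<le> 1 / m"
      using m(1) order_trans[OF m(2) that] by (simp add: field_simps)
    then show ?thesis
      by (meson norm_cauchy_schwarz mult_right_mono norm_ge_zero order_trans)
  qed
  then show ?thesis by (auto intro!: bdd_aboveI)
qed

lemma inner_le_norm_mult_dual_norm:
  assumes "is_norm N"
  shows "x \<bullet> y \<le> N x * dual_norm N y"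
proof (cases "x = 0")
  case False
  then have pos: "N x > 0"
    using is_normD(1,2)[OF assms, of x] by linarith
  then have "N ((1 / N x) *\<^sub>R x) = 1"
    by (simp add: is_normD(3)[OF assms])
  then have "((1 / N x) *\<^sub>R x) \<bullet> y \<le> dual_norm N y"
    unfolding dual_norm_def by (intro cSUP_upper bdd_above_dual_norm assms) simp
  then show ?thesis using pos by (simp add: field_simps)
qed (use is_normD(2)[OF assms, of 0] in simp)

lemma dual_norm_leI:
  assumes "is_norm N" "\<And>u. N u \<le> 1 \<Longrightarrow> u \<bullet> y \<le> c"
  shows "dual_norm N y \<le> c"
  unfolding dual_norm_def
proof (rule cSUP_least)
  have "N 0 \<le> 1" using is_normD(2)[OF assms(1), of 0] by simp
  then show "{x. N x \<le> 1} \<noteq> {}" by blast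
qed (use assms(2) in simp)

text \<open>
  The Hahn-Banach theorem in finite dimension: a hyperplane separates \<open>x\<close> from the open ball of
  radius \<open>N x\<close>, and its normal vector is rescaled so as to take the value \<open>N x\<close> at \<open>x\<close>.
\<close>

lemma norming_vector_exists:
  assumes N: "is_norm N"
  obtains y where "dual_norm N y \<le> 1" "x \<bullet> y = N x"
proof (cases "x = 0")
  case True
  have "dual_norm N 0 \<le> 1" by (rule dual_norm_leI[OF N]) simp
  then show thesis
    using True is_normD(2)[OF N, of 0] by (intro that[of 0]) auto
next
  case False
  then have pos: "N x > 0"
    using is_normD(1,2)[OF N, of x] by linarith
  let ?B = "{u. N u < N x}"
  have "convex ?B"
  proof (rule convexI)
    fix u v and s t :: real
    assume uv: "u \<in> ?B" "v \<in> ?B" and st: "0 \<le> s" "0 \<le> t" "s + t = 1"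
    have "N (s *\<^sub>R u + t *\<^sub>R v) \<le> s * N u + t * N v"
      using is_normD(4)[OF N, of "s *\<^sub>R u" "t *\<^sub>R v"] st by (simp add: is_normD(3)[OF N])
    also have "\<dots> < N x"
      using uv st by (intro convex_bound_lt) auto
    finally show "s *\<^sub>R u + t *\<^sub>R v \<in> ?B" by simp
  qed
  moreover have "0 \<in> ?B" using pos is_normD(2)[OF N, of 0] by simp
  ultimately obtain a b where a: "a \<noteq> 0" "\<And>u. u \<in> ?B \<Longrightarrow> a \<bullet> u \<le> b" "a \<bullet> x \<ge> b"
    using separating_hyperplane_sets[of ?B "{x}"] by fastforce
  then have sep: "a \<bullet> u \<le> a \<bullet> x" if "N u < N x" for u
    using that by fastforce
  have "N a > 0"
    using a(1) is_normD(1,2)[OF N, of a] by linarith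
  \<comment> \<open>A small positive multiple of \<open>a\<close> lies in the ball, which makes \<open>a \<bullet> x\<close> positive.\<close>
  then have "a \<bullet> ((N x / (2 * N a)) *\<^sub>R a) \<le> a \<bullet> x"
    using pos by (intro sep) (simp add: is_normD(3)[OF N])
  moreover have "a \<bullet> ((N x / (2 * N a)) *\<^sub>R a) > 0"
    using pos \<open>N a > 0\<close> a(1) by simp
  ultimately have ax: "a \<bullet> x > 0" by linarith
  let ?y = "(N x / (a \<bullet> x)) *\<^sub>R a"
  show thesis
  proof (rule that[of ?y])
    show "dual_norm N ?y \<le> 1"
    proof (rule dual_norm_leI[OF N])
      fix u assume u: "N u \<le> 1"
      \<comment> \<open>Shrinking by \<open>t < 1\<close> brings \<open>u\<close> into the open ball; then \<open>t\<close> tends to \<open>1\<close>.\<close>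
      show "u \<bullet> ?y \<le> 1"
      proof (rule field_le_mult_one_interval)
        fix t :: real assume t: "0 < t" "t < 1"
        have "t * N u < 1"
          using t u mult_left_mono[OF u, of t] by linarith
        then have "N ((t * N x) *\<^sub>R u) < N x"
          using pos t mult_strict_left_mono[of "t * N u" 1 "N x"]
          by (simp add: is_normD(3)[OF N] abs_mult mult_ac)
        from sep[OF this] show "t * (u \<bullet> ?y) \<le> 1"
          using ax by (simp add: field_simps inner_commute)
      qed
    qed
    show "x \<bullet> ?y = N x" using ax by (simp add: inner_commute)
  qed
qed

section \<open>Orthant-monotonicity and coordinate projections\<close>

lemma coord_proj_in_coord_subspace: "coord_proj K y \<in> coord_subspace K"
  by (simp add: coord_proj_def coord_subspace_def)

lemma coord_proj_id:
  assumes "x \<in> coord_subspace K"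
  shows "coord_proj K x = x"
  using assms by (auto simp: coord_proj_def coord_subspace_def vec_eq_iff)

lemma inner_coord_proj: "x \<bullet> coord_proj K y = coord_proj K x \<bullet> y"
  by (auto simp: coord_proj_def inner_vec_def intro!: sum.cong)

lemma coord_proj_eq_iff: "coord_proj K x = x \<longleftrightarrow> supp x \<subseteq> K"
  by (auto simp: coord_proj_def supp_def vec_eq_iff)

lemma supp_nonempty:
  assumes "x \<noteq> 0"
  shows "supp x \<noteq> {}"
  using assms by (auto simp: supp_def vec_eq_iff)

lemma orthant_strictly_monotonic_coord_proj_less:
  assumes "orthant_strictly_monotonic N" "\<not> supp y \<subseteq> K"
  shows "N (coord_proj K y) < N y"
proof -
  have "\<exists>i. \<bar>coord_proj K y $ i\<bar> < \<bar>y $ i\<bar>"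
    using assms(2) by (auto simp: coord_proj_def supp_def)
  moreover have "\<bar>coord_proj K y $ i\<bar> \<le> \<bar>y $ i\<bar>" "coord_proj K y $ i * y $ i \<ge> 0" for i
    by (auto simp: coord_proj_def)
  ultimately show ?thesis
    using assms(1) unfolding orthant_strictly_monotonic_def by blast
qed

lemma orthant_strictly_monotonic_coord_proj_le:
  assumes "orthant_strictly_monotonic N"
  shows "N (coord_proj K y) \<le> N y"
  using orthant_strictly_monotonic_coord_proj_less[OF assms, of y K] coord_proj_eq_iff[of K y]
  by (cases "supp y \<subseteq> K") auto

text \<open>
  Otherwise \<open>y\<close> would take the value \<open>N x\<close> also at the projection of \<open>x\<close> on the support of \<open>y\<close>,
  whose norm is strictly smaller.
\<close>

lemma norming_vector_supp:
  assumes "is_norm N" "orthant_strictly_monotonic N" "dual_norm N y \<le> 1" "x \<bullet> y = N x"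
  shows "supp x \<subseteq> supp y"
proof (rule ccontr)
  assume "\<not> supp x \<subseteq> supp y"
  then have less: "N (coord_proj (supp y) x) < N x"
    by (rule orthant_strictly_monotonic_coord_proj_less[OF assms(2)])
  have "N x = coord_proj (supp y) x \<bullet> y"
    by (metis assms(4) coord_proj_eq_iff inner_coord_proj order_refl)
  also have "\<dots> \<le> N (coord_proj (supp y) x) * dual_norm N y"
    by (rule inner_le_norm_mult_dual_norm[OF assms(1)])
  also have "\<dots> \<le> N (coord_proj (supp y) x)"
    using assms(3) is_normD(1)[OF assms(1)] by (simp add: mult_left_le)
  finally show False using less by simp
qed

section \<open>The local norms are restrictions\<close>

lemma local_top_dual_norm_eq:
  assumes "orthant_strictly_monotonic (dual_norm N)" "y \<in> coord_subspace K"
  shows "local_top_dual_norm N K y = dual_norm N y"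
  unfolding local_top_dual_norm_def
proof (rule cSup_eq_maximum)
  show "dual_norm N y \<in> (\<lambda>J. dual_norm N (coord_proj J y)) ` {J. J \<subseteq> K}"
    using coord_proj_id[OF assms(2)] by (intro image_eqI[of _ _ K]) auto
qed (auto intro: orthant_strictly_monotonic_coord_proj_le[OF assms(1)])

lemma local_support_dual_norm_eq:
  assumes N: "is_norm N" and mono: "orthant_strictly_monotonic (dual_norm N)"
    and x: "x \<in> coord_subspace K"
  shows "local_support_dual_norm N K x = N x"
  unfolding local_support_dual_norm_def
proof (rule cSup_eq_maximum)
  obtain y where y: "dual_norm N y \<le> 1" "x \<bullet> y = N x"
    using norming_vector_exists[OF N] by blast
  show "N x \<in> (\<lambda>y. x \<bullet> y) ` {y \<in> coord_subspace K. local_top_dual_norm N K y \<le> 1}"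
  proof (rule image_eqI)
    show "N x = x \<bullet> coord_proj K y"
      using y(2) coord_proj_id[OF x] by (simp add: inner_coord_proj)
    show "coord_proj K y \<in> {y \<in> coord_subspace K. local_top_dual_norm N K y \<le> 1}"
      using order_trans[OF orthant_strictly_monotonic_coord_proj_le[OF mono] y(1)]
      by (simp add: coord_proj_in_coord_subspace local_top_dual_norm_eq[OF mono])
  qed
next
  fix r assume "r \<in> (\<lambda>y. x \<bullet> y) ` {y \<in> coord_subspace K. local_top_dual_norm N K y \<le> 1}"
  then obtain y where "dual_norm N y \<le> 1" "r = x \<bullet> y"
    using local_top_dual_norm_eq[OF mono] by auto
  then show "r \<le> N x"
    using inner_le_norm_mult_dual_norm[OF N, of x y] mult_left_le[of "dual_norm N y" "N x"]
      is_normD(1)[OF N, of x] by linarith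
qed

section \<open>The minimisation problem\<close>

lemma feasible_iff:
  assumes "is_norm N" "orthant_strictly_monotonic (dual_norm N)"
  shows "feasible N x z \<longleftrightarrow>
           (\<forall>K. K \<noteq> {} \<longrightarrow> z K \<in> coord_subspace K) \<and>
           (\<Sum>K\<in>{K. K \<noteq> {}}. N (z K)) \<le> N x \<and> (\<Sum>K\<in>{K. K \<noteq> {}}. z K) = x"
proof -
  have "(\<Sum>K\<in>{K. K \<noteq> {}}. local_support_dual_norm N K (z K)) = (\<Sum>K\<in>{K. K \<noteq> {}}. N (z K))"
    if "\<forall>K. K \<noteq> {} \<longrightarrow> z K \<in> coord_subspace K"
    using that by (intro sum.cong) (auto simp: local_support_dual_norm_eq[OF assms])
  then show ?thesis unfolding feasible_def by auto
qed

lemma objective_eq: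
  assumes "is_norm N" "orthant_strictly_monotonic (dual_norm N)" "feasible N x z"
  shows "objective N F z = (\<Sum>K\<in>{K. K \<noteq> {}}. N (z K) * F K)"
  using assms(3) unfolding objective_def feasible_def
  by (intro sum.cong) (auto simp: local_support_dual_norm_eq[OF assms(1,2)])

text \<open>
  Evaluating a norming functional \<open>y\<close> of \<open>x\<close> on \<open>x = \<Sum>K. z K\<close> leaves no slack in the
  constraint, so \<open>y\<close> norms each piece. A nonzero piece in \<open>coord_subspace K\<close> only sees the projection
  of \<open>y\<close>, which has dual norm less than one as soon as \<open>K\<close> misses a point of the support of \<open>y\<close>.
\<close>

lemma feasible_vanishes:
  assumes N: "is_norm N" and mono: "orthant_strictly_monotonic N"
    and dmono: "orthant_strictly_monotonic (dual_norm N)" and feas: "feasible N x z"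
  shows "(\<Sum>K\<in>{K. K \<noteq> {}}. N (z K)) = N x"
    and "\<And>K. K \<noteq> {} \<Longrightarrow> \<not> supp x \<subseteq> K \<Longrightarrow> z K = 0"
proof -
  obtain y where y: "dual_norm N y \<le> 1" "x \<bullet> y = N x"
    using norming_vector_exists[OF N] by blast
  have sub: "z K \<in> coord_subspace K" if "K \<noteq> {}" for K
    using feas that by (simp add: feasible_def)
  have sum: "(\<Sum>K\<in>{K. K \<noteq> {}}. z K) = x" and le: "(\<Sum>K\<in>{K. K \<noteq> {}}. N (z K)) \<le> N x"
    using feas by (simp_all add: feasible_iff[OF N dmono])
  have inner_le: "u \<bullet> y \<le> N u" for u
    using inner_le_norm_mult_dual_norm[OF N, of u y] mult_left_le[OF y(1) is_normD(1)[OF N, of u]]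
    by linarith
  have inner_sum: "(\<Sum>K\<in>{K. K \<noteq> {}}. z K \<bullet> y) = N x"
    using y(2) sum by (simp add: inner_sum_left[symmetric])
  have "(\<Sum>K\<in>{K. K \<noteq> {}}. z K \<bullet> y) \<le> (\<Sum>K\<in>{K. K \<noteq> {}}. N (z K))"
    by (intro sum_mono inner_le)
  with inner_sum le show total: "(\<Sum>K\<in>{K. K \<noteq> {}}. N (z K)) = N x" by linarith
  fix K assume K: "K \<noteq> {}" "\<not> supp x \<subseteq> K"
  have "(\<Sum>K\<in>{K. K \<noteq> {}}. z K \<bullet> y) = (\<Sum>K\<in>{K. K \<noteq> {}}. N (z K))"
    using inner_sum total by simp
  then have "z K \<bullet> y = N (z K)"
    by (rule sum_mono_inv) (use K inner_le in auto)
  then have "N (z K) = z K \<bullet> coord_proj K y"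
    by (simp add: inner_coord_proj coord_proj_id[OF sub[OF K(1)]])
  also have "\<dots> \<le> N (z K) * dual_norm N (coord_proj K y)"
    by (rule inner_le_norm_mult_dual_norm[OF N])
  finally have norm_le: "N (z K) \<le> N (z K) * dual_norm N (coord_proj K y)" .
  have "\<not> supp y \<subseteq> K"
    using K(2) norming_vector_supp[OF N mono y] by blast
  from orthant_strictly_monotonic_coord_proj_less[OF dmono this] y(1)
  have "dual_norm N (coord_proj K y) < 1" by linarith
  with norm_le have "\<not> N (z K) > 0"
    using mult_strict_left_mono[of "dual_norm N (coord_proj K y)" 1 "N (z K)"] by auto
  then show "z K = 0"
    using is_normD(1,2)[OF N, of "z K"] by linarith
qed

lemma objective_ge:
  assumes N: "is_norm N" and mono: "orthant_strictly_monotonic N"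
    and dmono: "orthant_strictly_monotonic (dual_norm N)" and F: "mono F"
    and feas: "feasible N x z"
  shows "N x * F (supp x) \<le> objective N F z"
proof -
  have "N x * F (supp x) = (\<Sum>K\<in>{K. K \<noteq> {}}. N (z K) * F (supp x))"
    using feasible_vanishes(1)[OF N mono dmono feas] by (simp add: sum_distrib_right[symmetric])
  also have "\<dots> \<le> (\<Sum>K\<in>{K. K \<noteq> {}}. N (z K) * F K)"
  proof (rule sum_mono)
    fix K :: "'a set" assume K: "K \<in> {K. K \<noteq> {}}"
    show "N (z K) * F (supp x) \<le> N (z K) * F K"
    proof (cases "supp x \<subseteq> K")
      case True
      then show ?thesis
        using monoD[OF F] is_normD(1)[OF N] by (intro mult_left_mono)
    next
      case False
      then have "N (z K) = 0"
        using K feasible_vanishes(2)[OF N mono dmono feas] is_normD(2)[OF N] by auto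
      then show ?thesis by simp
    qed
  qed
  also have "\<dots> = objective N F z"
    by (rule objective_eq[OF N dmono feas, symmetric])
  finally show ?thesis .
qed

lemma concentrated_family:
  assumes N: "is_norm N" and dmono: "orthant_strictly_monotonic (dual_norm N)" and "supp x \<noteq> {}"
  defines "z \<equiv> \<lambda>K. if K = supp x then x else 0"
  shows "feasible N x z" "objective N F z = N x * F (supp x)"
proof -
  have "N 0 = 0" using is_normD(2)[OF N] by simp
  then have Nz: "N (z K) = (if K = supp x then N x else 0)" for K
    by (simp add: z_def)
  have "z K \<in> coord_subspace K" for K
    by (auto simp: z_def coord_subspace_def supp_def)
  moreover have "(\<Sum>K\<in>{K. K \<noteq> {}}. N (z K)) = N x"
    using assms(3) by (simp add: Nz)
  moreover have "(\<Sum>K\<in>{K. K \<noteq> {}}. z K) = x"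
    using assms(3) by (simp add: z_def)
  ultimately show feas: "feasible N x z"
    by (simp add: feasible_iff[OF N dmono])
  have "N (z K) * F K = (if K = supp x then N x * F K else 0)" for K
    by (simp add: Nz)
  then show "objective N F z = N x * F (supp x)"
    using assms(3) by (simp add: objective_eq[OF N dmono feas])
qed

theorem theorem16:
  fixes N :: "real ^ 'n \<Rightarrow> real" and F :: "'n set \<Rightarrow> real"
  assumes "is_norm N"
    and "orthant_strictly_monotonic N"
    and "orthant_strictly_monotonic (dual_norm N)"
    and "mono F"
    and "F {} = 0"
  shows "(\<forall>x. x \<noteq> 0 \<longrightarrow>
            (\<exists>z. is_arg_min (objective N F) (feasible N x) z) \<and>
            F (supp x) = 1 / N x * (LEAST m. \<exists>z. feasible N x z \<and> m = objective N F z)) \<and>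
         (\<forall>x L. supp x = L \<and> L \<noteq> {} \<longrightarrow>
            is_arg_min (objective N F) (feasible N x) (\<lambda>K. if K = L then x else 0))"
proof -
  note ge = objective_ge[OF assms(1-4)]
  note family = concentrated_family[OF assms(1,3)]
  have arg_min: "is_arg_min (objective N F) (feasible N x) (\<lambda>K. if K = supp x then x else 0)"
    if "supp x \<noteq> {}" for x
    using family[OF that] ge by (simp add: is_arg_min_linorder)
  have "F (supp x) = 1 / N x * (LEAST m. \<exists>z. feasible N x z \<and> m = objective N F z)"
    if "x \<noteq> 0" for x
  proof -
    note supp = supp_nonempty[OF that]
    have "(LEAST m. \<exists>z. feasible N x z \<and> m = objective N F z) = N x * F (supp x)"
      by (rule Least_equality) (use family[OF supp] ge in force)+
    then show ?thesis
      using that is_normD(2)[OF assms(1)] by simp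
  qed
  then show ?thesis
    using arg_min supp_nonempty by blast
qed

end
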